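(* Let $(X,d)$ be a metric space and $\delta\colon X\times X\to[0,\infty)$ a semimetric. Suppose there exists a constant $K\ge1$ such that for all $x,y\in X$ with $d(x,y)>0$, $$\frac1K\le\frac{\delta(x,y)}{d(x,y)}\le K.$$ Assume that $T\colon X\to X$ is an additive-type contraction with coefficient $\beta\in[0,1)$: $$d(Tx,Ty)+\delta(Tx,Ty)\le\beta\,\big(d(x,y)+\delta(x,y)\big)\quad\text{for all }x,y\in X.$$ If $\beta<\frac{2\sqrt K}{1+K}$, then $T$ is an A.M.-G.M. contraction with coefficient $\alpha=\beta\cdot\frac{1+K}{2\sqrt K}$; that is, $\alpha\in[0,1)$ and for all $x,y\in X$, $$\frac{d(Tx,Ty)+\delta(Tx,Ty)}{2}\le\alpha\,\sqrt{d(x,y)\,\delta(x,y)}.$$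
   Context: A semimetric on a nonempty set $X$ is a map $\delta\colon X\times X\to[0,\infty)$ such that $\delta(x,y)=0$ if and only if $x=y$, and $\delta(x,y)=\delta(y,x)$ for all $x,y\in X$ (no triangle inequality is required). *)

theory Defs
  imports "HOL-Analysis.Abstract_Metric_Spaces"
begin

definition semimetric_on :: "'a set \<Rightarrow> ('a \<Rightarrow> 'a \<Rightarrow> real) \<Rightarrow> bool" where
  "semimetric_on X \<delta> \<longleftrightarrow>
     X \<noteq> {} \<and>
     (\<forall>x\<in>X. \<forall>y\<in>X. 0 \<le> \<delta> x y) \<and>
     (\<forall>x\<in>X. \<forall>y\<in>X. \<delta> x y = 0 \<longleftrightarrow> x = y) \<and>
     (\<forall>x\<in>X. \<forall>y\<in>X. \<delta> x y = \<delta> y x)"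

definition additive_contraction ::
  "'a set \<Rightarrow> ('a \<Rightarrow> 'a \<Rightarrow> real) \<Rightarrow> ('a \<Rightarrow> 'a \<Rightarrow> real) \<Rightarrow> ('a \<Rightarrow> 'a) \<Rightarrow> real \<Rightarrow> bool" where
  "additive_contraction X d \<delta> T \<beta> \<longleftrightarrow>
     T \<in> X \<rightarrow> X \<and> 0 \<le> \<beta> \<and> \<beta> < 1 \<and>
     (\<forall>x\<in>X. \<forall>y\<in>X. d (T x) (T y) + \<delta> (T x) (T y) \<le> \<beta> * (d x y + \<delta> x y))"

definition am_gm_contraction ::
  "'a set \<Rightarrow> ('a \<Rightarrow> 'a \<Rightarrow> real) \<Rightarrow> ('a \<Rightarrow> 'a \<Rightarrow> real) \<Rightarrow> ('a \<Rightarrow> 'a) \<Rightarrow> real \<Rightarrow> bool" where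
  "am_gm_contraction X d \<delta> T \<alpha> \<longleftrightarrow>
     T \<in> X \<rightarrow> X \<and> 0 \<le> \<alpha> \<and> \<alpha> < 1 \<and>
     (\<forall>x\<in>X. \<forall>y\<in>X. (d (T x) (T y) + \<delta> (T x) (T y)) / 2 \<le> \<alpha> * sqrt (d x y * \<delta> x y))"

end

(* If a and b have ratio in [1/K, K], then (K a - b)(K b - a) \<ge> 0, which rearranges to
   K (a + b)^2 \<le> (1 + K)^2 a b: the arithmetic mean exceeds the geometric mean by a factor
   of at most (1 + K) / (2 sqrt K). *)
theory Submission
  imports Defs
begin

text \<open>The ratio bounds are cleared of denominators so that \<open>a = b = 0\<close> is
  covered, as is needed for \<open>x = y\<close>. The left side is the sum and not the mean, hence
  no 2 in the factor.\<close>

lemma sum_le_sqrt_mult_of_ratio_bounds: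
  fixes a b K :: real
  assumes "0 < K" "0 \<le> a" "0 \<le> b" "a \<le> K * b" "b \<le> K * a"
  shows "a + b \<le> (1 + K) / sqrt K * sqrt (a * b)"
proof -
  have "0 \<le> (K * a - b) * (K * b - a)"
    using assms by simp
  also have "\<dots> = (1 + K)\<^sup>2 * (a * b) - K * (a + b)\<^sup>2"
    by (simp add: power2_eq_square algebra_simps)
  finally have "sqrt (K * (a + b)\<^sup>2) \<le> sqrt ((1 + K)\<^sup>2 * (a * b))"
    by simp
  \<comment> \<open>The roots of the two squares are absolute values, which drop because
    \<open>a + b\<close> and \<open>1 + K\<close> are nonnegative.\<close>
  then have "sqrt K * (a + b) \<le> (1 + K) * sqrt (a * b)"
    using assms by (simp add: real_sqrt_mult)
  then show ?thesis
    using \<open>0 < K\<close> by (simp add: field_simps)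
qed

theorem theorem5p1:
  fixes X :: "'a set" and d \<delta> :: "'a \<Rightarrow> 'a \<Rightarrow> real" and T :: "'a \<Rightarrow> 'a" and K \<beta> :: real
  assumes "Metric_space X d"
    and "semimetric_on X \<delta>"
    and "K \<ge> 1"
    and "\<And>x y. x \<in> X \<Longrightarrow> y \<in> X \<Longrightarrow> d x y > 0 \<Longrightarrow> 1 / K \<le> \<delta> x y / d x y \<and> \<delta> x y / d x y \<le> K"
    and "additive_contraction X d \<delta> T \<beta>"
    and "\<beta> < 2 * sqrt K / (1 + K)"
  shows "am_gm_contraction X d \<delta> T (\<beta> * ((1 + K) / (2 * sqrt K)))"
proof -
  interpret Metric_space X d by fact
  have T: "T \<in> X \<rightarrow> X" and \<beta>: "0 \<le> \<beta>"
    and contr: "\<And>x y. x \<in> X \<Longrightarrow> y \<in> X \<Longrightarrow> d (T x) (T y) + \<delta> (T x) (T y) \<le> \<beta> * (d x y + \<delta> x y)"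
    using assms(5) by (auto simp: additive_contraction_def)
  have "0 < K"
    using assms(3) by simp
  \<comment> \<open>The bound assumed on \<open>\<beta>\<close> is the reciprocal of this positive
    factor.\<close>
  have "\<beta> * ((1 + K) / (2 * sqrt K)) < 1"
    using assms(6) \<open>0 < K\<close> by (simp add: field_simps)
  moreover have "(d (T x) (T y) + \<delta> (T x) (T y)) / 2
      \<le> \<beta> * ((1 + K) / (2 * sqrt K)) * sqrt (d x y * \<delta> x y)"
    if xy: "x \<in> X" "y \<in> X" for x y
  proof -
    \<comment> \<open>Off the diagonal, the lower ratio bound gives the first inequality and the
      upper one the second. On it the ratio hypothesis is silent, but both distances vanish.\<close>
    have "d x y \<le> K * \<delta> x y \<and> \<delta> x y \<le> K * d x y"
    proof (cases "x = y")
      case True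
      then have "d x y = 0" "\<delta> x y = 0"
        using xy assms(2) by (simp_all add: semimetric_on_def)
      then show ?thesis
        by simp
    next
      case False
      then have "0 < d x y"
        using xy by simp
      then show ?thesis
        using assms(4)[OF xy] \<open>0 < K\<close> by (simp add: field_simps)
    qed
    moreover have "0 \<le> \<delta> x y"
      using xy assms(2) by (simp add: semimetric_on_def)
    ultimately have "d x y + \<delta> x y \<le> (1 + K) / sqrt K * sqrt (d x y * \<delta> x y)"
      using \<open>0 < K\<close> by (intro sum_le_sqrt_mult_of_ratio_bounds) auto
    \<comment> \<open>The left side is the additive contraction bound; halving the chained
      inequality supplies the missing 2 in the coefficient.\<close>
    then have "\<beta> * (d x y + \<delta> x y) \<le> \<beta> * ((1 + K) / sqrt K * sqrt (d x y * \<delta> x y))"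
      using \<beta> by (rule mult_left_mono)
    with contr[OF xy] show ?thesis
      by simp
  qed
  ultimately show ?thesis
    using T \<beta> \<open>0 < K\<close> by (simp add: am_gm_contraction_def)
qed

end
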